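(* For all $k\ge 3$ and $n\ge 2^k$, $$\#\bigl(\{(p_u,s_u): u\in\mathrm{Fac}_n(\mathbf{t})\}/\!\equiv_k\bigr)=\begin{cases}3\cdot 2^k-3, & \text{if } n\equiv 0\pmod{2^k};\\ 3\cdot 2^k-4, & \text{otherwise.}\end{cases}$$
   Context: $A=\{0,1\}$, $\varphi(0)=01$, $\varphi(1)=10$; $\mathbf{t}$ is the fixed point of $\varphi$ starting with $0$, letters indexed from $0$, $\mathbf{t}_{[i,j)}$ its factor at positions $i,\ldots,j-1$; $\mathrm{Fac}_n(\mathbf{t})$ is the set of factors of length $n$. $\bar a$ is the complement of a letter $a$. For a factor $u$, $\mathrm{Cut}_k(u)=\{([i,i+|u|]\cap 2^k\mathbb{N})-i : i\in\mathbb{N},\ u=\mathbf{t}_{[i,i+|u|)}\}$. If $|u|\ge 2^k-1$ and $C\in\mathrm{Cut}_k(u)$, there are unique words $p,s,v'$ with $u=p\varphi^k(v')s$, $|p|=\min C$, $|s|=|u|-\max C$, $p$ empty or a proper suffix of some $\varphi^k(a)$, $s$ empty or a proper prefix of some $\varphi^k(b)$ ($a,b\in A$); $(p,s)$ is the factorization of order $k$ associated with $C$, and $(p_u,s_u)$ is the factorization of order $k$ of $u$ with $|p_u|$ minimal. The equivalence $\equiv_k$ on $A^{<2^k}\times A^{<2^k}$: $(p_1,s_1)\equiv_k(p_2,s_2)$ iff there is $a\in A$ such that either (1) $|p_1|+|s_1|=|p_2|+|s_2|$ and one of (a) $(p_1,s_1)=(p_2,s_2)$; (b) $(p_1,\varphi^{k-1}(a)s_1)=(p_2\varphi^{k-1}(a),s_2)$;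 (c) $(p_2,\varphi^{k-1}(a)s_2)=(p_1\varphi^{k-1}(a),s_1)$; (d) $(p_1,s_1)=(s_2,p_2)=(\varphi^{k-1}(a),\varphi^{k-1}(\bar a))$; or (2) $\bigl||p_1|+|s_1|-(|p_2|+|s_2|)\bigr|=2^k$ and one of (a) $(p_1,s_1)=(p_2\varphi^{k-1}(a),\varphi^{k-1}(\bar a)s_2)$; (b) $(p_2,s_2)=(p_1\varphi^{k-1}(a),\varphi^{k-1}(\bar a)s_1)$. *)

theory Defs
  imports Main "HOL-Library.Sublist"
begin

text \<open>
  The alphabet is \<^typ>\<open>bool\<close>, with \<^const>\<open>False\<close> for the letter 0 and \<^const>\<open>True\<close> for the
  letter 1; the complement of a letter is its negation. Finite words are lists and infinite words
  are functions on \<^typ>\<open>nat\<close>.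
\<close>

fun tm_letter :: "bool \<Rightarrow> bool list" where
  "tm_letter False = [False, True]"
| "tm_letter True = [True, False]"

definition tm_morph :: "bool list \<Rightarrow> bool list" where
  "tm_morph w = concat (map tm_letter w)"

text \<open>On infinite words: every letter is replaced by a block of length 2, so position \<open>i\<close> of the
  image lies in the block of the letter at position \<open>i div 2\<close>.\<close>

definition tm_morph_inf :: "(nat \<Rightarrow> bool) \<Rightarrow> nat \<Rightarrow> bool" where
  "tm_morph_inf x i = tm_letter (x (i div 2)) ! (i mod 2)"

definition thue_morse :: "nat \<Rightarrow> bool" where
  "thue_morse = (THE x. x 0 = False \<and> tm_morph_inf x = x)"

lemma tm_letter_nth: "tm_letter a ! (i mod 2) = (a \<noteq> odd i)"
  by (cases a; cases "even i") (simp_all add: odd_iff_mod_2_eq_one)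

lemma ex1_tm_fixed_point: "\<exists>!x. x 0 = False \<and> tm_morph_inf x = x"
proof -
  define h :: "nat \<Rightarrow> nat \<Rightarrow> bool" where
    "h = rec_nat (\<lambda>_. False) (\<lambda>_ g i. g (i div 2) \<noteq> odd i)"
  have h0: "h 0 i = False" and hS: "h (Suc m) i = (h m (i div 2) \<noteq> odd i)" for m i
    by (simp_all add: h_def)
  have stable: "i \<le> m \<Longrightarrow> i \<le> m' \<Longrightarrow> h m i = h m' i" for i m m'
  proof (induction i arbitrary: m m' rule: less_induct)
    case (less i)
    have z: "h l 0 = False" for l
      by (induction l) (simp_all add: h0 hS)
    show ?case
    proof (cases "i = 0")
      case True
      then show ?thesis by (simp add: z)
    next
      case False
      then obtain l l' where l: "m = Suc l" "m' = Suc l'"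
        using less.prems by (metis le_zero_eq old.nat.exhaust)
      have "h l (i div 2) = h l' (i div 2)"
        using False less.prems l by (intro less.IH) auto
      then show ?thesis by (simp add: l hS)
    qed
  qed
  define x where "x i = h i i" for i
  have rec: "x i = (x (i div 2) \<noteq> odd i)" for i
  proof (cases i)
    case 0
    then show ?thesis by (simp add: x_def h0)
  next
    case (Suc m)
    have "h m (i div 2) = h (i div 2) (i div 2)"
      using Suc by (intro stable) auto
    then show ?thesis using Suc hS[of m i] by (simp add: x_def)
  qed
  show ?thesis
  proof (rule ex1I[of _ x])
    show "x 0 = False \<and> tm_morph_inf x = x"
      unfolding fun_eq_iff tm_morph_inf_def tm_letter_nth
      by (simp only: rec[symmetric]) (simp add: x_def h0)
  next
    fix y assume y: "y 0 = False \<and> tm_morph_inf y = y"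
    have yrec: "y i = (y (i div 2) \<noteq> odd i)" for i
      using y by (metis tm_morph_inf_def tm_letter_nth)
    have "y i = x i" for i
    proof (induction i rule: less_induct)
      case (less i)
      show ?case
      proof (cases "i = 0")
        case True
        then show ?thesis using y by (simp add: x_def h0)
      next
        case False
        then have "y (i div 2) = x (i div 2)" by (intro less.IH) auto
        then show ?thesis using rec[of i] yrec[of i] by simp
      qed
    qed
    then show "y = x" by (simp add: fun_eq_iff)
  qed
qed

lemma thue_morse_0: "thue_morse 0 = False"
  and thue_morse_fixed: "tm_morph_inf thue_morse = thue_morse"
  using theI'[OF ex1_tm_fixed_point] by (simp_all add: thue_morse_def)

text \<open>\<open>tm_factor i j\<close> occupies the positions \<open>i, \<dots>, j - 1\<close>.\<close>

definition tm_factor :: "nat \<Rightarrow> nat \<Rightarrow> bool list" where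
  "tm_factor i j = map thue_morse [i..<j]"

definition Fac :: "nat \<Rightarrow> bool list set" where
  "Fac n = {tm_factor i (i + n) | i. True}"

definition Cut :: "nat \<Rightarrow> bool list \<Rightarrow> nat set set" where
  "Cut k u = {(\<lambda>m. m - i) ` ({i..i + length u} \<inter> {2 ^ k * m | m. True}) | i.
                u = tm_factor i (i + length u)}"

definition is_factorization ::
  "nat \<Rightarrow> bool list \<Rightarrow> nat set \<Rightarrow> bool list \<times> bool list \<Rightarrow> bool" where
  "is_factorization k u C = (\<lambda>(p, s).
     (\<exists>v. u = p @ (tm_morph ^^ k) v @ s) \<and>
     length p = Min C \<and> length s = length u - Max C \<and>
     (p = [] \<or> (\<exists>a. strict_suffix p ((tm_morph ^^ k) [a]))) \<and>
     (s = [] \<or> (\<exists>b. strict_prefix s ((tm_morph ^^ k) [b]))))"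

text \<open>The pair \<open>(p\<^sub>u, s\<^sub>u)\<close>. For \<open>length u \<ge> 2 ^ k - 1\<close> the minimiser exists and is unique, because
  a set in \<open>Cut k u\<close> is determined by its minimum.\<close>

definition min_factorization :: "nat \<Rightarrow> bool list \<Rightarrow> bool list \<times> bool list" where
  "min_factorization k u =
     (ARG_MIN (\<lambda>(p, s). length p) ps. \<exists>C \<in> Cut k u. is_factorization k u C ps)"

definition fact_equiv ::
  "nat \<Rightarrow> ((bool list \<times> bool list) \<times> (bool list \<times> bool list)) set" where
  "fact_equiv k = {((p1, s1), (p2, s2)).
     length p1 < 2 ^ k \<and> length s1 < 2 ^ k \<and> length p2 < 2 ^ k \<and> length s2 < 2 ^ k \<and>
     (\<exists>a. let x = (tm_morph ^^ (k - 1)) [a]; y = (tm_morph ^^ (k - 1)) [\<not> a] in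
        length p1 + length s1 = length p2 + length s2 \<and>
          ((p1, s1) = (p2, s2) \<or>
           (p1, x @ s1) = (p2 @ x, s2) \<or>
           (p2, x @ s2) = (p1 @ x, s1) \<or>
           (p1, s1) = (s2, p2) \<and> (s2, p2) = (x, y)) \<or>
        \<bar>int (length p1 + length s1) - int (length p2 + length s2)\<bar> = 2 ^ k \<and>
          ((p1, s1) = (p2 @ x, y @ s2) \<or>
           (p2, s2) = (p1 @ x, y @ s1)))}"

text \<open>
  As a relation on all pairs of words shorter than \<open>2 ^ k\<close>, \<^const>\<open>fact_equiv\<close> is not transitive: for
  nonempty \<open>q\<close>, with \<open>q\<close> and \<open>s\<close> shorter than \<open>2 ^ (k - 1)\<close>, it relates \<open>(q, s)\<close> to both \<open>(q @ x, y @ s)\<close> and \<open>(q @ y, x @ s)\<close>, but not these two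
  to each other. At most one of the latter arises from a factor of the Thue-Morse word, since \<open>q\<close> is
  then a suffix of only one of \<open>x\<close> and \<open>y\<close>. The quotient of a set \<open>S\<close> of factorizations is therefore
  taken with respect to the restriction of the relation to \<open>S\<close>.
\<close>

definition fact_quotient ::
  "nat \<Rightarrow> (bool list \<times> bool list) set \<Rightarrow> (bool list \<times> bool list) set set" where
  "fact_quotient k S = S // (fact_equiv k \<inter> S \<times> S)"

end

theory Submission
  imports Defs
begin

text \<open>
  Put \<open>j = k - 1\<close> and cut an occurrence of a factor \<open>u\<close> of length \<open>n \<ge> 2\<^sup>k\<close> into half blocks
  \<open>\<phi>\<^sup>j(a)\<close>, leaving remainders \<open>p'\<close>, \<open>s'\<close> shorter than \<open>2\<^sup>j\<close> at both ends. By synchronization this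
  cutting depends on \<open>u\<close> only, although the cutting into blocks \<open>\<phi>\<^sup>k(a)\<close> need not. The signature of \<open>u\<close>
  consists of \<open>p'\<close>, \<open>s'\<close> and the number of half blocks \<open>\<phi>\<^sup>j(1)\<close> minus the number of half blocks
  \<open>\<phi>\<^sup>j(0)\<close>. Full blocks contribute 0 to this difference, so it can be read off any factorization of
  order \<open>k\<close>, and two factorizations are equivalent iff their signatures agree. In particular the
  minimality of \<open>p\<^sub>u\<close> plays no role for the count. There are 6 signatures for each \<open>|p'| < 2\<^sup>j\<close>, except that
  one empty remainder leaves only 4, and two empty ones leave 3 or 2 according to the parity of
  \<open>n / 2\<^sup>j\<close>.
\<close>

subsection \<open>The Thue-Morse word\<close>

lemma thue_morse_rec: "thue_morse i = (thue_morse (i div 2) \<noteq> odd i)"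
  by (metis tm_morph_inf_def tm_letter_nth thue_morse_fixed)

lemma thue_morse_double [simp]: "thue_morse (2 * i) = thue_morse i"
  using thue_morse_rec[of "2 * i"] by simp

lemma thue_morse_Suc_double [simp]: "thue_morse (Suc (2 * i)) = (\<not> thue_morse i)"
  using thue_morse_rec[of "Suc (2 * i)"] by simp

lemma thue_morse_add_double: "thue_morse (i + 2 * x) = (thue_morse (i div 2 + x) \<noteq> odd i)"
  using thue_morse_rec[of "i + 2 * x"] by (simp add: add.commute)

lemma thue_morse_pow_add:
  "x < 2 ^ j \<Longrightarrow> thue_morse (2 ^ j * q + x) = (thue_morse q \<noteq> thue_morse x)"
proof (induction j arbitrary: x)
  case 0
  then show ?case by (simp add: thue_morse_0)
next
  case (Suc j)
  have "(2 ^ Suc j * q + x) div 2 = 2 ^ j * q + x div 2"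
    by (simp add: mult.assoc)
  moreover have "thue_morse (2 ^ j * q + x div 2) = (thue_morse q \<noteq> thue_morse (x div 2))"
    using Suc.prems by (intro Suc.IH) auto
  ultimately show ?case
    using thue_morse_rec[of "2 ^ Suc j * q + x"] thue_morse_rec[of x] by auto
qed

lemma thue_morse_pow_mult [simp]: "thue_morse (2 ^ j * q) = thue_morse q"
  using thue_morse_pow_add[of 0 j q] by (simp add: thue_morse_0)

text \<open>One of \<open>i\<close> and \<open>Suc i\<close> is even, and the letters at
  \<open>2 * x\<close> and \<open>Suc (2 * x)\<close> always differ.\<close>

lemma thue_morse_no_cube:
  "\<not> (thue_morse i = thue_morse (Suc i) \<and> thue_morse (Suc i) = thue_morse (Suc (Suc i)))"
proof (cases "even i")
  case True
  then obtain x where "i = 2 * x" by blast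
  then show ?thesis by simp
next
  case False
  then obtain x where "i = Suc (2 * x)" by (metis oddE Suc_eq_plus1)
  then show ?thesis
    using thue_morse_double[of "Suc x"] thue_morse_Suc_double[of "Suc x"] by simp
qed

text \<open>Induction by halving the distance: doubling both positions turns distance
  \<open>x\<close> into \<open>2 * x\<close>, and moving the second one a step further gives
  \<open>Suc (2 * x)\<close> with that letter complemented. This later realises every
  context.\<close>

lemma thue_morse_pair:
  "d \<ge> 1 \<Longrightarrow> \<exists>i. thue_morse i = a \<and> thue_morse (i + d) = b"
proof (induction d arbitrary: a b rule: less_induct)
  case (less d)
  consider "d = 1" | x where "d = 2 * x" "x \<ge> 1" | x where "d = Suc (2 * x)" "x \<ge> 1"
    by (metis One_nat_def Suc_eq_plus1 evenE less.prems less_one linorder_not_le mult_0_right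
        oddE not_less_zero)
  then show ?case
  proof cases
    case 1
    \<comment> \<open>The word begins 0110100, where the pairs 01, 11, 10, 00 occur at positions 0,
      1, 2, 5.\<close>
    have "thue_morse 1" "thue_morse 2" "\<not> thue_morse 3" "\<not> thue_morse 5" "\<not> thue_morse 6"
      using thue_morse_rec[of 1] thue_morse_rec[of 2] thue_morse_rec[of 3] thue_morse_rec[of 5]
        thue_morse_rec[of 6] by (simp_all add: thue_morse_0)
    with 1 thue_morse_0 show ?thesis
      by (cases a; cases b) (auto intro: exI[of _ 0] exI[of _ 1] exI[of _ 2] exI[of _ 5]
          simp: numeral_2_eq_2 numeral_3_eq_3 eval_nat_numeral)
  next
    case (2 x)
    then obtain i where "thue_morse i = a \<and> thue_morse (i + x) = b"
      using less.IH[of x] by auto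
    then show ?thesis
      using 2 thue_morse_double[of i] thue_morse_double[of "i + x"]
      by (intro exI[of _ "2 * i"]) simp
  next
    case (3 x)
    then obtain i where "thue_morse i = a \<and> thue_morse (i + x) = (\<not> b)"
      using less.IH[of x] by auto
    then show ?thesis
      using 3 thue_morse_double[of i] thue_morse_Suc_double[of "i + x"]
      by (intro exI[of _ "2 * i"]) simp
  qed
qed

section \<open>Synchronization: long factors fix positions modulo powers of 2\<close>

lemma thue_morse_sync_parity:
  assumes "\<And>x. x < 4 \<Longrightarrow> thue_morse (i + x) = thue_morse (j + x)" and "even i"
  shows "even j"
proof (rule ccontr)
  assume "odd j"
  then obtain b where j: "j = Suc (2 * b)" by (metis oddE Suc_eq_plus1)
  obtain a where i: "i = 2 * a" using assms(2) by blast
  have "thue_morse i = thue_morse j"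
    "thue_morse (Suc i) = thue_morse (Suc j)"
    "thue_morse (Suc (Suc i)) = thue_morse (Suc (Suc j))"
    "thue_morse (Suc (Suc (Suc i))) = thue_morse (Suc (Suc (Suc j)))"
    using assms(1)[of 0] assms(1)[of 1] assms(1)[of 2] assms(1)[of 3]
    by (simp_all add: eval_nat_numeral)
  \<comment> \<open>Since \<open>i\<close> is even, the first two of the four letters differ, and so
    do the last two. Read from \<open>j = Suc (2 * b)\<close>, this makes the letters at
    \<open>b\<close>, \<open>b + 1\<close>, \<open>b + 2\<close> equal.\<close>
  then show False
    using thue_morse_no_cube[of b] i j
      thue_morse_double[of a] thue_morse_Suc_double[of a]
      thue_morse_double[of "Suc a"] thue_morse_Suc_double[of "Suc a"]
      thue_morse_Suc_double[of b] thue_morse_double[of "Suc b"]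
      thue_morse_Suc_double[of "Suc b"] thue_morse_double[of "Suc (Suc b)"]
    by auto
qed

text \<open>Four letters fix the parity of the position; once parities agree, \<open>i div 2\<close>
  and \<open>j div 2\<close> start equal factors of half the length.\<close>

lemma thue_morse_sync:
  assumes "\<And>x. x < n \<Longrightarrow> thue_morse (i + x) = thue_morse (j + x)" and "2 * 2 ^ r \<le> n"
  shows "i mod 2 ^ r = j mod 2 ^ r"
  using assms
proof (induction r arbitrary: n i j)
  case 0
  then show ?case by simp
next
  case (Suc r)
  have "1 \<le> (2::nat) ^ r" by simp
  then have n: "n \<ge> 4" using Suc.prems(2) unfolding power_Suc by linarith
  have parity: "even i \<longleftrightarrow> even j"
    using thue_morse_sync_parity[of i j] thue_morse_sync_parity[of j i] Suc.prems(1) n by auto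
  have "(i div 2) mod 2 ^ r = (j div 2) mod 2 ^ r"
  proof (rule Suc.IH[of "n div 2"])
    show "thue_morse (i div 2 + x) = thue_morse (j div 2 + x)" if "x < n div 2" for x
    proof -
      have "2 * x < n" using that by linarith
      then show ?thesis
        using Suc.prems(1)[of "2 * x"] parity thue_morse_add_double[of i x]
          thue_morse_add_double[of j x] by auto
    qed
    show "2 * 2 ^ r \<le> n div 2" using Suc.prems(2) by auto
  qed
  with parity show ?case
    by (simp add: mod_mult2_eq mod2_eq_if)
qed

subsection \<open>The morphism and its powers\<close>

lemma tm_morph_append: "tm_morph (v @ w) = tm_morph v @ tm_morph w"
  by (simp add: tm_morph_def)

lemma tm_morph_pow_append: "(tm_morph ^^ j) (v @ w) = (tm_morph ^^ j) v @ (tm_morph ^^ j) w"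
  by (induction j) (simp_all add: tm_morph_append)

lemma tm_morph_pow_Nil [simp]: "(tm_morph ^^ j) [] = []"
  by (induction j) (simp_all add: tm_morph_def)

lemma length_tm_morph: "length (tm_morph v) = 2 * length v"
proof -
  have "length (tm_letter a) = 2" for a by (cases a) auto
  then show ?thesis by (induction v) (simp_all add: tm_morph_def)
qed

lemma length_tm_morph_pow [simp]: "length ((tm_morph ^^ j) v) = 2 ^ j * length v"
  by (induction j) (simp_all add: length_tm_morph)

lemma inj_tm_morph: "inj tm_morph"
proof (rule injI)
  show "v = w" if "tm_morph v = tm_morph w" for v w
    using that
  proof (induction v arbitrary: w)
    case Nil
    then show ?case using length_tm_morph[of w] length_tm_morph[of "[]"] by simp
  next
    case (Cons a v)
    then obtain b w' where w: "w = b # w'"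
      using length_tm_morph[of w] length_tm_morph[of "a # v"] by (cases w) auto
    have "tm_letter a @ tm_morph v = tm_letter b @ tm_morph w'"
      using Cons.prems w by (simp add: tm_morph_def)
    then show ?case using Cons.IH[of w'] w by (cases a; cases b) auto
  qed
qed

lemma tm_morph_pow_eq_iff [simp]: "(tm_morph ^^ j) v = (tm_morph ^^ j) w \<longleftrightarrow> v = w"
  using inj_fn[OF inj_tm_morph, of j] by (auto simp: inj_def)

lemma length_tm_factor [simp]: "length (tm_factor i j) = j - i"
  by (simp add: tm_factor_def)

lemma nth_tm_factor: "x < j - i \<Longrightarrow> tm_factor i j ! x = thue_morse (i + x)"
  by (simp add: tm_factor_def)

lemma tm_factor_eq_Nil_iff [simp]: "tm_factor i j = [] \<longleftrightarrow> j \<le> i"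
  by (auto simp: tm_factor_def)

lemma tm_factor_singleton [simp]: "tm_factor c (Suc c) = [thue_morse c]"
  by (simp add: tm_factor_def)

lemma tm_factor_append: "i \<le> j \<Longrightarrow> j \<le> l \<Longrightarrow> tm_factor i j @ tm_factor j l = tm_factor i l"
  using upt_add_eq_append[of i j "l - j"] by (simp add: tm_factor_def)

lemma tm_morph_tm_factor: "tm_morph (tm_factor c d) = tm_factor (2 * c) (2 * d)"
proof (induction d)
  case 0
  then show ?case by (simp add: tm_factor_def tm_morph_def)
next
  case (Suc d)
  have "tm_morph [thue_morse d] = [thue_morse (2 * d), thue_morse (Suc (2 * d))]"
    by (cases "thue_morse d") (simp_all add: tm_morph_def)
  then show ?case
    using Suc by (auto simp: tm_factor_def tm_morph_append)
qed

lemma tm_morph_pow_tm_factor: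
  "(tm_morph ^^ j) (tm_factor c d) = tm_factor (2 ^ j * c) (2 ^ j * d)"
  by (induction j) (simp_all add: tm_morph_tm_factor mult.assoc)

lemma tm_morph_pow_singleton:
  "(tm_morph ^^ j) [thue_morse c] = tm_factor (2 ^ j * c) (2 ^ j * Suc c)"
  using tm_morph_pow_tm_factor[of j c "Suc c"] by simp

lemma nth_tm_morph_pow_singleton:
  assumes "x < 2 ^ j"
  shows "(tm_morph ^^ j) [a] ! x = (a \<noteq> thue_morse x)"
proof -
  \<comment> \<open>Every letter occurs in the word, so its block can be read there, starting at a
    multiple of \<open>2 ^ j\<close>.\<close>
  obtain c where c: "thue_morse c = a" using thue_morse_pair[of 1 a a] by auto
  show ?thesis
    using tm_morph_pow_singleton[of j c] assms
    by (simp add: c nth_tm_factor thue_morse_pow_add)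
qed

subsection \<open>The equivalence in terms of half blocks\<close>

definition weight :: "bool list \<Rightarrow> int" where
  "weight w = sum_list (map (\<lambda>a. if a then 1 else - 1) w)"

lemma weight_Nil [simp]: "weight [] = 0"
  and weight_Cons [simp]: "weight (a # w) = (if a then 1 else - 1) + weight w"
  and weight_append [simp]: "weight (v @ w) = weight v + weight w"
  by (simp_all add: weight_def)

text \<open>The total length modulo \<open>2 ^ j\<close> is the length of the remainder, so both
  sides are cut at the same place.\<close>

lemma append_tm_morph_pow_cancel:
  assumes "length p < 2 ^ j" "length q < 2 ^ j"
    and "p @ (tm_morph ^^ j) v = q @ (tm_morph ^^ j) w"
  shows "p = q \<and> v = w"
proof -
  have "length p + 2 ^ j * length v = length q + 2 ^ j * length w"
    using arg_cong[OF assms(3), of length] by simp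
  then have "(length p + 2 ^ j * length v) mod 2 ^ j = (length q + 2 ^ j * length w) mod 2 ^ j"
    by simp
  then have "length p = length q" using assms(1,2) by simp
  then show ?thesis using assms(3) by simp
qed

lemma tm_morph_pow_append_cancel:
  assumes "length s < 2 ^ j" "length r < 2 ^ j"
    and "(tm_morph ^^ j) v @ s = (tm_morph ^^ j) w @ r"
  shows "s = r \<and> v = w"
proof -
  have "length s + 2 ^ j * length v = length r + 2 ^ j * length w"
    using arg_cong[OF assms(3), of length] by simp
  then have "(length s + 2 ^ j * length v) mod 2 ^ j = (length r + 2 ^ j * length w) mod 2 ^ j"
    by simp
  then have "length s = length r" using assms(1,2) by simp
  then show ?thesis using assms(3) by simp
qed

text \<open>Apart from equality, a clause of the relation moves one half block to the other side,
  swaps two opposite half blocks, or inserts or deletes an opposite pair. None of this changes the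
  total weight or the remainders.\<close>

lemma fact_equiv_imp_weight_eq:
  assumes "((p1 @ (tm_morph ^^ j) e1, (tm_morph ^^ j) g1 @ s1),
            (p2 @ (tm_morph ^^ j) e2, (tm_morph ^^ j) g2 @ s2)) \<in> fact_equiv (Suc j)"
    and p: "length p1 < 2 ^ j" "length p2 < 2 ^ j"
    and s: "length s1 < 2 ^ j" "length s2 < 2 ^ j"
  shows "p1 = p2 \<and> s1 = s2 \<and> weight e1 + weight g1 = weight e2 + weight g2"
proof -
  let ?X = "tm_morph ^^ j"
  have P: "q = q' \<and> v = w @ u"
    if "q @ ?X v = (q' @ ?X w) @ ?X u" "length q < 2 ^ j" "length q' < 2 ^ j" for q q' u v w
    using append_tm_morph_pow_cancel[of q j q' v "w @ u"] that by (simp add: tm_morph_pow_append)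
  have S: "r = r' \<and> u @ v = u' @ w"
    if "?X u @ ?X v @ r = ?X u' @ ?X w @ r'" "length r < 2 ^ j" "length r' < 2 ^ j"
    for r r' u u' v w
    using tm_morph_pow_append_cancel[of r j r' "u @ v" "u' @ w"] that
    by (simp add: tm_morph_pow_append)
  have P0: "q = q' \<and> v = w" if "q @ ?X v = q' @ ?X w" "length q < 2 ^ j" "length q' < 2 ^ j"
    for q q' v w using append_tm_morph_pow_cancel that by blast
  \<comment> \<open>The clauses of the relation, padded with \<open>[]\<close> and
    \<open>?X []\<close> so that the cancellation facts match their shape.\<close>
  from assms(1) obtain a where
    "(p1 @ ?X e1 = p2 @ ?X e2 \<and> ?X g1 @ s1 = ?X g2 @ s2) \<or>
     (p1 @ ?X e1 = (p2 @ ?X e2) @ ?X [a] \<and> ?X [a] @ ?X g1 @ s1 = ?X [] @ ?X g2 @ s2) \<or>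
     (p2 @ ?X e2 = (p1 @ ?X e1) @ ?X [a] \<and> ?X [a] @ ?X g2 @ s2 = ?X [] @ ?X g1 @ s1) \<or>
     (p1 @ ?X e1 = [] @ ?X [a] \<and> p2 @ ?X e2 = [] @ ?X [\<not> a] \<and>
      ?X g1 @ s1 = ?X [\<not> a] @ [] \<and> ?X g2 @ s2 = ?X [a] @ []) \<or>
     (p1 @ ?X e1 = (p2 @ ?X e2) @ ?X [a] \<and> ?X [] @ ?X g1 @ s1 = ?X [\<not> a] @ ?X g2 @ s2) \<or>
     (p2 @ ?X e2 = (p1 @ ?X e1) @ ?X [a] \<and> ?X [] @ ?X g2 @ s2 = ?X [\<not> a] @ ?X g1 @ s1)"
    unfolding fact_equiv_def Let_def by auto metis+
  then show ?thesis
  proof (elim disjE conjE, goal_cases)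
    case 1
    then show ?case using append_tm_morph_pow_cancel tm_morph_pow_append_cancel p s by metis
  next
    case 2
    show ?case using P[OF 2(1)] S[OF 2(2)] p s by auto
  next
    case 3
    show ?case using P[OF 3(1)] S[OF 3(2)] p s by auto
  next
    case 4
    have "p1 = [] \<and> e1 = [a]" "p2 = [] \<and> e2 = [\<not> a]"
      using append_tm_morph_pow_cancel[OF _ _ 4(1)] append_tm_morph_pow_cancel[OF _ _ 4(2)] p
      by simp_all
    moreover have "s1 = [] \<and> g1 = [\<not> a]" "s2 = [] \<and> g2 = [a]"
      using tm_morph_pow_append_cancel[OF _ _ 4(3)] tm_morph_pow_append_cancel[OF _ _ 4(4)] s
      by simp_all
    ultimately show ?case by simp
  next
    case 5
    show ?case using P[OF 5(1)] S[OF 5(2)] p s by auto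
  next
    case 6
    show ?case using P[OF 6(1)] S[OF 6(2)] p s by auto
  qed
qed

text \<open>The hypotheses \<open>last\<close> and \<open>hd\<close> say that a nonempty remainder \<open>p\<close> or \<open>s\<close> already determines
  the half block next to it; they exclude the non-transitive configurations of the relation.\<close>

lemma weight_eq_imp_fact_equiv:
  assumes "length p < 2 ^ j" "length s < 2 ^ j"
    and e: "length e1 \<le> 1" "length e2 \<le> 1" and g: "length g1 \<le> 1" "length g2 \<le> 1"
    and parity: "even (length e1 + length g1) \<longleftrightarrow> even (length e2 + length g2)"
    and last: "\<And>a. p \<noteq> [] \<Longrightarrow> e1 = [a] \<Longrightarrow> last p = f a"
      "\<And>a. p \<noteq> [] \<Longrightarrow> e2 = [a] \<Longrightarrow> last p = f a"
    and hd: "\<And>a. s \<noteq> [] \<Longrightarrow> g1 = [a] \<Longrightarrow> hd s = f' a"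
      "\<And>a. s \<noteq> [] \<Longrightarrow> g2 = [a] \<Longrightarrow> hd s = f' a"
    and inj: "inj f" "inj f'"
    and weight: "weight e1 + weight g1 = weight e2 + weight g2"
  shows "((p @ (tm_morph ^^ j) e1, (tm_morph ^^ j) g1 @ s),
          (p @ (tm_morph ^^ j) e2, (tm_morph ^^ j) g2 @ s)) \<in> fact_equiv (Suc j)"
proof -
  have *: "length e = 0 \<or> length e = 1 \<Longrightarrow> e = [] \<or> e = [True] \<or> e = [False]" for e :: "bool list"
    by (cases e) auto
  have P: "p = []" if "e1 = [a]" "e2 = [\<not> a]" for a
    using last(1)[of a] last(2)[of "\<not> a"] that injD[OF inj(1), of a "\<not> a"] by auto
  have S: "s = []" if "g1 = [a]" "g2 = [\<not> a]" for a
    using hd(1)[of a] hd(2)[of "\<not> a"] that injD[OF inj(2), of a "\<not> a"] by auto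
  from e g have
    "e1 = [] \<or> e1 = [True] \<or> e1 = [False]" "e2 = [] \<or> e2 = [True] \<or> e2 = [False]"
    "g1 = [] \<or> g1 = [True] \<or> g1 = [False]" "g2 = [] \<or> g2 = [True] \<or> g2 = [False]"
    by (auto intro!: * simp: le_Suc_eq)
  \<comment> \<open>With at most one half block on each side, equal parity and equal weight leave
    only these six configurations, each an instance of one clause of the relation.\<close>
  then have "(e1 = e2 \<and> g1 = g2) \<or>
      (\<exists>a. e1 = [a] \<and> g1 = [] \<and> e2 = [] \<and> g2 = [a]) \<or>
      (\<exists>a. e2 = [a] \<and> g2 = [] \<and> e1 = [] \<and> g1 = [a]) \<or>
      (\<exists>a. e1 = [a] \<and> g1 = [\<not> a] \<and> e2 = [] \<and> g2 = []) \<or>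
      (\<exists>a. e2 = [a] \<and> g2 = [\<not> a] \<and> e1 = [] \<and> g1 = []) \<or>
      (\<exists>a. e1 = [a] \<and> g1 = [\<not> a] \<and> e2 = [\<not> a] \<and> g2 = [a])"
    using parity weight by (elim disjE) (simp_all add: ex_bool_eq)
  then show ?thesis
  proof (elim disjE exE conjE, goal_cases)
    case 1
    have "length e1 = 0 \<or> length e1 = 1" "length g1 = 0 \<or> length g1 = 1" using e g by linarith+
    with 1 assms(1,2) show ?case by (auto simp: fact_equiv_def Let_def)
  next
    case (2 a)
    with assms(1,2) show ?case by (auto simp: fact_equiv_def Let_def intro!: exI[of _ a])
  next
    case (3 a)
    with assms(1,2) show ?case by (auto simp: fact_equiv_def Let_def intro!: exI[of _ a])
  next
    case (4 a)
    with assms(1,2) show ?case by (auto simp: fact_equiv_def Let_def intro!: exI[of _ a])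
  next
    case (5 a)
    with assms(1,2) show ?case by (auto simp: fact_equiv_def Let_def intro!: exI[of _ a])
  next
    case (6 a)
    \<comment> \<open>The swap clause admits no remainders. A nonempty \<open>p\<close> would end in
      both \<open>f a\<close> and \<open>f (\<not> a)\<close>, against injectivity; likewise for
      \<open>s\<close>.\<close>
    then have "p = []" "s = []" using P S[of "\<not> a"] by simp_all
    with 6 show ?case by (auto simp: fact_equiv_def Let_def intro!: exI[of _ a])
  qed
qed

subsection \<open>Factorizations and their signatures\<close>

text \<open>For \<open>m > 0\<close>, the first block boundary at or after \<open>i\<close> is
  \<open>m * ceil_div i m\<close>; the last one at or before \<open>i + n\<close> is given by
  ordinary division.\<close>

definition ceil_div :: "nat \<Rightarrow> nat \<Rightarrow> nat" where
  "ceil_div i m = (i + m - 1) div m"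

lemma le_mult_ceil_div: "m > 0 \<Longrightarrow> i \<le> m * ceil_div i m"
  using div_mult_mod_eq[of "i + m - 1" m] mod_less_divisor[of m "i + m - 1"]
  unfolding ceil_div_def mult.commute[of m] by linarith

lemma mult_ceil_div_less: "m > 0 \<Longrightarrow> m * ceil_div i m < i + m"
  using div_mult_mod_eq[of "i + m - 1" m]
  unfolding ceil_div_def mult.commute[of m] by linarith

lemma ceil_div_eqI:
  assumes "i + x = m * c" "x < m"
  shows "ceil_div i m = c"
proof -
  have "i + m - 1 = (m - 1 - x) + m * c" using assms by linarith
  moreover have "m - 1 - x < m" using assms(2) by linarith
  ultimately show ?thesis unfolding ceil_div_def by (metis add.right_neutral div_less div_mult_self2
        less_nat_zero_code)
qed

lemma ceil_div_le:
  assumes "i \<le> m * c" "m > 0"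
  shows "ceil_div i m \<le> c"
proof -
  have "m * ceil_div i m < m * Suc c"
    using mult_ceil_div_less[OF assms(2), of i] assms(1) unfolding mult_Suc_right by linarith
  then show ?thesis using mult_less_cancel1 less_Suc_eq_le by blast
qed

lemma ceil_div_double: "m > 0 \<Longrightarrow> ceil_div i (2 * m) = (ceil_div i m + 1) div 2"
proof -
  assume m: "m > 0"
  have "(i + 2 * m - 1) div m = ((i + m - 1) + m) div m"
    using m by (intro arg_cong[of _ _ "\<lambda>x. x div m"]) linarith
  also have "\<dots> = ceil_div i m + 1" unfolding ceil_div_def using m by (intro div_add_self2) simp
  finally show ?thesis
    unfolding ceil_div_def[of i "2 * m"] by (metis div_mult2_eq mult.commute)
qed

text \<open>Indexed by an occurrence instead of a cut set, because one factor may have several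
  cuttings into blocks of order \<open>k\<close>.\<close>

definition factorization_at :: "nat \<Rightarrow> nat \<Rightarrow> nat \<Rightarrow> bool list \<times> bool list" where
  "factorization_at k n i =
     (tm_factor i (2 ^ k * ceil_div i (2 ^ k)), tm_factor (2 ^ k * ((i + n) div 2 ^ k)) (i + n))"

lemma cut_bounds:
  assumes "2 ^ k \<le> n"
  shows "i \<le> 2 ^ k * ceil_div i (2 ^ k)"
    and "2 ^ k * ceil_div i (2 ^ k) \<le> 2 ^ k * ((i + n) div 2 ^ k)"
    and "2 ^ k * ((i + n) div 2 ^ k) \<le> i + n"
    and "2 ^ k * ceil_div i (2 ^ k) < i + 2 ^ k"
    and "i + n < 2 ^ k * ((i + n) div 2 ^ k) + 2 ^ k"
proof -
  show "i \<le> 2 ^ k * ceil_div i (2 ^ k)" by (simp add: le_mult_ceil_div)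
  show *: "2 ^ k * ceil_div i (2 ^ k) < i + 2 ^ k" by (simp add: mult_ceil_div_less)
  show "2 ^ k * ((i + n) div 2 ^ k) \<le> i + n" by simp
  have "ceil_div i (2 ^ k) \<le> (i + n) div 2 ^ k"
    using * assms by (simp add: less_eq_div_iff_mult_less_eq mult.commute)
  then show "2 ^ k * ceil_div i (2 ^ k) \<le> 2 ^ k * ((i + n) div 2 ^ k)" by simp
  show "i + n < 2 ^ k * ((i + n) div 2 ^ k) + 2 ^ k"
    using dividend_less_times_div[of "2 ^ k" "i + n"] by simp
qed

lemma Min_Max_cut:
  fixes i k n :: nat
  assumes "2 ^ k \<le> n"
  defines "C \<equiv> (\<lambda>m. m - i) ` ({i..i + n} \<inter> {2 ^ k * m | m. True})"
  shows "Min C = 2 ^ k * ceil_div i (2 ^ k) - i" and "Max C = 2 ^ k * ((i + n) div 2 ^ k) - i"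
proof -
  note b = cut_bounds[OF assms(1), of i]
  have fin: "finite C" by (simp add: C_def)
  show "Min C = 2 ^ k * ceil_div i (2 ^ k) - i"
  proof (rule Min_eqI[OF fin])
    fix y assume "y \<in> C"
    then obtain q where "y = 2 ^ k * q - i" "i \<le> 2 ^ k * q" by (auto simp: C_def)
    moreover from this have "2 ^ k * ceil_div i (2 ^ k) \<le> 2 ^ k * q" by (simp add: ceil_div_le)
    ultimately show "2 ^ k * ceil_div i (2 ^ k) - i \<le> y" by linarith
  next
    show "2 ^ k * ceil_div i (2 ^ k) - i \<in> C"
      unfolding C_def using b(1) order_trans[OF b(2,3)] by (intro imageI) auto
  qed
  show "Max C = 2 ^ k * ((i + n) div 2 ^ k) - i"
  proof (rule Max_eqI[OF fin])
    fix y assume "y \<in> C"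
    then obtain q where q: "y = 2 ^ k * q - i" "2 ^ k * q \<le> i + n" by (auto simp: C_def)
    from q(2) have "q \<le> (i + n) div 2 ^ k"
      by (simp add: less_eq_div_iff_mult_less_eq mult.commute)
    then have "2 ^ k * q \<le> 2 ^ k * ((i + n) div 2 ^ k)" by simp
    with q(1) show "y \<le> 2 ^ k * ((i + n) div 2 ^ k) - i" by linarith
  next
    show "2 ^ k * ((i + n) div 2 ^ k) - i \<in> C"
      unfolding C_def using b(3) order_trans[OF b(1,2)] by (intro imageI) auto
  qed
qed

text \<open>The cut prescribes the lengths of both remainders and thereby the remainders.
  Conversely, these are pieces of the blocks in which the occurrence begins and ends.\<close>

lemma is_factorization_iff:
  assumes "2 ^ k \<le> n"
  shows "is_factorization k (tm_factor i (i + n))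
           ((\<lambda>m. m - i) ` ({i..i + n} \<inter> {2 ^ k * m | m. True})) ps
         \<longleftrightarrow> ps = factorization_at k n i"
proof -
  define c d where "c = ceil_div i (2 ^ k)" and "d = (i + n) div 2 ^ k"
  note b = cut_bounds[OF assms, of i, folded c_def d_def]
  have u: "tm_factor i (i + n)
      = tm_factor i (2 ^ k * c) @ tm_factor (2 ^ k * c) (2 ^ k * d) @ tm_factor (2 ^ k * d) (i + n)"
    using b by (metis le_trans tm_factor_append)
  show ?thesis
  proof
    assume "is_factorization k (tm_factor i (i + n))
           ((\<lambda>m. m - i) ` ({i..i + n} \<inter> {2 ^ k * m | m. True})) ps"
    then obtain p s v where ps: "ps = (p, s)" "tm_factor i (i + n) = p @ v @ s"
      "length p = 2 ^ k * c - i" "length s = i + n - 2 ^ k * d"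
      unfolding is_factorization_def Min_Max_cut[OF assms] c_def[symmetric] d_def[symmetric]
      using b by (cases ps) auto
    from ps(2) u have "p @ v @ s = tm_factor i (2 ^ k * c) @
        tm_factor (2 ^ k * c) (2 ^ k * d) @ tm_factor (2 ^ k * d) (i + n)" by simp
    with ps(3,4) have "p = tm_factor i (2 ^ k * c)" "s = tm_factor (2 ^ k * d) (i + n)"
      by (simp_all add: append_eq_append_conv)
    then show "ps = factorization_at k n i"
      by (simp add: ps(1) factorization_at_def c_def d_def)
  next
    assume ps: "ps = factorization_at k n i"
    have "\<exists>a. strict_suffix (tm_factor i (2 ^ k * c)) ((tm_morph ^^ k) [a])"
      if "tm_factor i (2 ^ k * c) \<noteq> []"
    proof -
      \<comment> \<open>A nonempty left remainder lies in the block of index \<open>c - 1\<close>,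
        which starts strictly before \<open>i\<close>.\<close>
      from that obtain x where x: "c = Suc x" by (cases c) auto
      have "(tm_morph ^^ k) [thue_morse x] = tm_factor (2 ^ k * x) i @ tm_factor i (2 ^ k * c)"
        using b that x by (simp add: tm_morph_pow_singleton tm_factor_append)
      moreover have "tm_factor (2 ^ k * x) i \<noteq> []" using b x by simp
      ultimately show ?thesis by (auto simp: strict_suffix_def suffix_def)
    qed
    moreover have "\<exists>a. strict_prefix (tm_factor (2 ^ k * d) (i + n)) ((tm_morph ^^ k) [a])"
    proof -
      have "(tm_morph ^^ k) [thue_morse d]
          = tm_factor (2 ^ k * d) (i + n) @ tm_factor (i + n) (2 ^ k * Suc d)"
        using b by (simp add: tm_morph_pow_singleton tm_factor_append)
      moreover have "tm_factor (i + n) (2 ^ k * Suc d) \<noteq> []" using b by simp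
      ultimately show ?thesis by (metis strict_prefixI' neq_Nil_conv)
    qed
    moreover have "\<exists>v. tm_factor i (i + n)
        = tm_factor i (2 ^ k * c) @ (tm_morph ^^ k) v @ tm_factor (2 ^ k * d) (i + n)"
      using u tm_morph_pow_tm_factor by metis
    ultimately show "is_factorization k (tm_factor i (i + n))
           ((\<lambda>m. m - i) ` ({i..i + n} \<inter> {2 ^ k * m | m. True})) ps"
      unfolding is_factorization_def Min_Max_cut[OF assms] ps factorization_at_def
        c_def[symmetric] d_def[symmetric]
      using b order_trans[OF b(1,2)] by auto
  qed
qed

text \<open>A minimiser satisfies the predicate it minimises over, so it comes from some occurrence
  of the same word, possibly other than the one at \<open>i\<close>.\<close>

lemma min_factorization_eq_factorization_at:
  assumes "2 ^ k \<le> n"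
  obtains j where "tm_factor j (j + n) = tm_factor i (i + n)"
    and "min_factorization k (tm_factor i (i + n)) = factorization_at k n j"
proof -
  let ?u = "tm_factor i (i + n)"
  let ?P = "\<lambda>ps. \<exists>C\<in>Cut k ?u. is_factorization k ?u C ps"
  have P: "?P ps \<longleftrightarrow> (\<exists>j. ?u = tm_factor j (j + n) \<and> ps = factorization_at k n j)" for ps
  proof -
    have "?P ps \<longleftrightarrow> (\<exists>j. ?u = tm_factor j (j + n) \<and> is_factorization k ?u
             ((\<lambda>m. m - j) ` ({j..j + n} \<inter> {2 ^ k * m | m. True})) ps)"
      unfolding Cut_def by auto
    moreover have "is_factorization k ?u
        ((\<lambda>m. m - j) ` ({j..j + n} \<inter> {2 ^ k * m | m. True})) ps \<longleftrightarrow> ps = factorization_at k n j"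
      if "?u = tm_factor j (j + n)" for j
      unfolding that by (rule is_factorization_iff[OF assms])
    ultimately show ?thesis by blast
  qed
  have "?P (factorization_at k n i)" unfolding P by blast
  then have "?P (min_factorization k ?u)"
    unfolding min_factorization_def by (rule arg_min_natI[where P = ?P])
  then obtain j where "tm_factor i (i + n) = tm_factor j (j + n)"
    "min_factorization k ?u = factorization_at k n j"
    unfolding P by blast
  then show thesis using that[of j] by simp
qed

text \<open>The order here is \<open>j = k - 1\<close>. The complete half blocks are the images of
  the letters with indices from \<open>ceil_div i (2 ^ j)\<close> up to, but excluding,
  \<open>(i + n) div 2 ^ j\<close>, so the weight is taken of these letters.\<close>

definition signature :: "nat \<Rightarrow> nat \<Rightarrow> nat \<Rightarrow> bool list \<times> bool list \<times> int" where
  "signature j n i =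
     (tm_factor i (2 ^ j * ceil_div i (2 ^ j)), tm_factor (2 ^ j * ((i + n) div 2 ^ j)) (i + n),
      weight (tm_factor (ceil_div i (2 ^ j)) ((i + n) div 2 ^ j)))"

lemma signature_eq:
  assumes "i + m = 2 ^ j * c" "m < 2 ^ j" "n = m + 2 ^ j * N + l" "l < 2 ^ j"
  shows "signature j n i =
     (tm_factor i (i + m), tm_factor (2 ^ j * (c + N)) (2 ^ j * (c + N) + l),
      weight (tm_factor c (c + N)))"
proof -
  have "i + n = l + 2 ^ j * (c + N)" using assms by (simp add: algebra_simps)
  then show ?thesis
    using ceil_div_eqI[OF assms(1,2)] assms(1,4) by (simp add: signature_def add.commute)
qed

lemma weight_tm_factor_double: "weight (tm_factor (2 * a) (2 * b)) = 0"
proof (induction b)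
  case 0
  then show ?case by (simp add: tm_factor_def)
next
  case (Suc b)
  show ?case
  proof (cases "a \<le> b")
    case True
    have "tm_factor (2 * a) (2 * Suc b) = tm_factor (2 * a) (2 * b) @ tm_factor (2 * b) (2 * Suc b)"
      using True by (simp add: tm_factor_append)
    also have "tm_factor (2 * b) (2 * Suc b) = [thue_morse b, \<not> thue_morse b]"
      by (simp add: tm_factor_def)
    finally show ?thesis using Suc by simp
  next
    case False
    then have "tm_factor (2 * a) (2 * Suc b) = []" by simp
    then show ?thesis by (metis weight_Nil)
  qed
qed

text \<open>Letters between even indices form pairs of weight 0. As \<open>c < d\<close>, rounding
  \<open>c\<close> up and \<open>d\<close> down to even numbers does not make them cross.\<close>

lemma weight_tm_factor_split:
  assumes "c < d"
  shows "weight (tm_factor c d) =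
    weight (tm_factor c (2 * ((c + 1) div 2))) + weight (tm_factor (2 * (d div 2)) d)"
proof -
  let ?c = "2 * ((c + 1) div 2)" and ?d = "2 * (d div 2)"
  have "c \<le> ?c" "?c \<le> ?d" "?d \<le> d" using assms by auto
  then have "tm_factor c d = tm_factor c ?c @ tm_factor ?c ?d @ tm_factor ?d d"
    by (simp add: tm_factor_append)
  then show ?thesis using weight_tm_factor_double by simp
qed

text \<open>Block boundaries of order \<open>Suc j\<close> are the half block boundaries of even
  index, so each remainder of order \<open>Suc j\<close> is one of order \<open>j\<close> with at
  most one half block attached.\<close>

lemma factorization_at_Suc:
  fixes i j n :: nat
  assumes "2 * 2 ^ j \<le> n"
  defines "c \<equiv> ceil_div i (2 ^ j)" and "d \<equiv> (i + n) div 2 ^ j"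
  shows "factorization_at (Suc j) n i =
    (tm_factor i (2 ^ j * c) @ (tm_morph ^^ j) (tm_factor c (2 * ((c + 1) div 2))),
     (tm_morph ^^ j) (tm_factor (2 * (d div 2)) d) @ tm_factor (2 ^ j * d) (i + n))"
proof -
  have "2 ^ j \<le> n" using assms(1) by simp
  note b = cut_bounds[OF this, of i, folded c_def d_def]
  have "ceil_div i (2 ^ Suc j) = (c + 1) div 2" by (simp add: ceil_div_double c_def)
  moreover have "(i + n) div 2 ^ Suc j = d div 2"
    unfolding d_def by (metis div_mult2_eq power_Suc2)
  moreover have "2 ^ j * c \<le> 2 ^ j * (2 * ((c + 1) div 2))"
    and "2 ^ j * (2 * (d div 2)) \<le> 2 ^ j * d" by (intro mult_le_mono2; simp)+
  ultimately show ?thesis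
    using b unfolding factorization_at_def
    by (simp add: tm_morph_pow_tm_factor tm_factor_append mult.assoc mult.left_commute)
qed

lemma fact_equiv_iff_signature_eq:
  assumes n: "2 * 2 ^ j \<le> n"
  shows "(factorization_at (Suc j) n i, factorization_at (Suc j) n i') \<in> fact_equiv (Suc j)
         \<longleftrightarrow> signature j n i = signature j n i'"
proof -
  have n': "2 ^ j \<le> n" using n by simp
  define p e g s where
    "p = (\<lambda>i. tm_factor i (2 ^ j * ceil_div i (2 ^ j)))" and
    "e = (\<lambda>i. tm_factor (ceil_div i (2 ^ j)) (2 * ((ceil_div i (2 ^ j) + 1) div 2)))" and
    "g = (\<lambda>i. tm_factor (2 * ((i + n) div 2 ^ j div 2)) ((i + n) div 2 ^ j))" and
    "s = (\<lambda>i. tm_factor (2 ^ j * ((i + n) div 2 ^ j)) (i + n))"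
  note bounds = cut_bounds[OF n']
  have fact: "factorization_at (Suc j) n i
      = (p i @ (tm_morph ^^ j) (e i), (tm_morph ^^ j) (g i) @ s i)" for i
    unfolding factorization_at_Suc[OF n] p_def e_def g_def s_def ..
  have less: "ceil_div i (2 ^ j) < (i + n) div 2 ^ j" for i
  proof -
    have "2 ^ j * ceil_div i (2 ^ j) < 2 ^ j * ((i + n) div 2 ^ j)"
      using bounds[of i] n by linarith
    then show ?thesis by simp
  qed
  have sig: "signature j n i = (p i, s i, weight (e i) + weight (g i))" for i
    unfolding signature_def p_def e_def g_def s_def
    using weight_tm_factor_split[OF less[of i]] by simp
  have len: "length (p i) < 2 ^ j" "length (s i) < 2 ^ j" for i
    using bounds[of i] by (simp_all add: p_def s_def)
  have len_e: "length (e i) = ceil_div i (2 ^ j) mod 2" for i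
  proof -
    have "2 * ((c + 1) div 2) - c = c mod 2" for c :: nat by presburger
    then show ?thesis by (simp add: e_def)
  qed
  have len_g: "length (g i) = (i + n) div 2 ^ j mod 2" for i
    by (simp add: g_def minus_mult_div_eq_mod)
  have len1: "length (e i) \<le> 1" "length (g i) \<le> 1" for i
    unfolding len_e len_g by linarith+
  \<comment> \<open>Here \<open>e i\<close> is the second half of a block and \<open>p i\<close> a
    suffix of the first half, which belongs to the complementary letter.\<close>
  have last: "last (p i) = (a = thue_morse (2 ^ j - 1))" if "p i \<noteq> []" "e i = [a]" for i a
  proof -
    define c where "c = ceil_div i (2 ^ j)"
    have "odd c" using len_e[of i] that(2) by (simp add: c_def odd_iff_mod_2_eq_one)
    then obtain x where c: "c = Suc (2 * x)" by (metis oddE Suc_eq_plus1)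
    then have a: "a = (\<not> thue_morse x)"
      using that(2) tm_factor_singleton[of c] by (simp add: e_def c_def[symmetric])
    have "i < 2 ^ j * c" using that(1) by (simp add: p_def c_def)
    then have "last (p i) = thue_morse (2 ^ j * c - 1)"
      using that(1) by (simp add: last_conv_nth p_def c_def[symmetric] nth_tm_factor)
    also have "2 ^ j * c - 1 = 2 ^ j * (2 * x) + (2 ^ j - 1)"
      by (simp add: c)
    also have "thue_morse \<dots> = (thue_morse x \<noteq> thue_morse (2 ^ j - 1))"
      by (subst thue_morse_pow_add) auto
    finally show ?thesis using a by auto
  qed
  \<comment> \<open>Here \<open>g i\<close> is the first half of a block and \<open>s i\<close> a
    prefix of the complementary second half.\<close>
  have hd: "hd (s i) = (\<not> a)" if "s i \<noteq> []" "g i = [a]" for i a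
  proof -
    define d where "d = (i + n) div 2 ^ j"
    have "odd d" using len_g[of i] that(2) by (simp add: d_def odd_iff_mod_2_eq_one)
    then obtain x where d: "d = Suc (2 * x)" by (metis oddE Suc_eq_plus1)
    then have a: "a = thue_morse x"
      using that(2) by (simp add: g_def d_def[symmetric])
    have "hd (s i) = thue_morse (2 ^ j * d)"
      using that(1) by (simp add: hd_conv_nth s_def d_def[symmetric] nth_tm_factor)
    then show ?thesis using a d by (simp del: mult_Suc_right)
  qed
  have parity: "even (length (e i) + length (g i)) \<longleftrightarrow> even ((i + n) div 2 ^ j - ceil_div i (2 ^ j))"
    for i
  proof -
    have "even (c mod 2 + d mod 2) = even (d - c)" if "c < d" for c d :: nat
      using that by presburger
    then show ?thesis unfolding len_e len_g using less by blast
  qed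
  \<comment> \<open>The lengths of the remainders determine the number of complete half blocks;
    hence equal signatures give the required equal parities.\<close>
  have N: "2 ^ j * ((i + n) div 2 ^ j - ceil_div i (2 ^ j)) = n - length (p i) - length (s i)" for i
    unfolding p_def s_def length_tm_factor diff_mult_distrib2 using bounds[of i] by linarith
  show ?thesis
  proof
    assume "(factorization_at (Suc j) n i, factorization_at (Suc j) n i') \<in> fact_equiv (Suc j)"
    then show "signature j n i = signature j n i'"
      unfolding fact sig using fact_equiv_imp_weight_eq len by blast
  next
    assume "signature j n i = signature j n i'"
    then have eq: "p i = p i'" "s i = s i'" "weight (e i) + weight (g i) = weight (e i') + weight (g i')"
      unfolding sig by blast+
    have "2 ^ j * ((i + n) div 2 ^ j - ceil_div i (2 ^ j))
        = 2 ^ j * ((i' + n) div 2 ^ j - ceil_div i' (2 ^ j))"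
      unfolding N eq ..
    then have parity': "even (length (e i) + length (g i)) \<longleftrightarrow> even (length (e i') + length (g i'))"
      unfolding parity by simp
    have "((p i @ (tm_morph ^^ j) (e i), (tm_morph ^^ j) (g i) @ s i),
          (p i @ (tm_morph ^^ j) (e i'), (tm_morph ^^ j) (g i') @ s i)) \<in> fact_equiv (Suc j)"
    proof (rule weight_eq_imp_fact_equiv)
      show "last (p i) = (a = thue_morse (2 ^ j - 1))" if "p i \<noteq> []" "e i' = [a]" for a
        using last[of i' a] that unfolding eq by blast
      show "hd (s i) = (\<not> a)" if "s i \<noteq> []" "g i' = [a]" for a
        using hd[of i' a] that unfolding eq by blast
    qed (use last[of i] hd[of i] eq(3) parity' len len1 in \<open>auto simp: inj_def\<close>)
    then show "(factorization_at (Suc j) n i, factorization_at (Suc j) n i') \<in> fact_equiv (Suc j)"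
      unfolding fact using eq(1,2) by metis
  qed
qed

text \<open>Length \<open>2 * 2 ^ j\<close> synchronizes positions modulo \<open>2 ^ j\<close>, so
  both occurrences are cut into half blocks at the same places. The letter behind each half block
  equals the first letter of that half block.\<close>

lemma signature_cong:
  assumes n: "2 * 2 ^ j \<le> n" and eq: "tm_factor i (i + n) = tm_factor i' (i' + n)"
  shows "signature j n i = signature j n i'"
proof -
  have letter: "thue_morse (i + x) = thue_morse (i' + x)" if "x < n" for x
    using arg_cong[OF eq, of "\<lambda>w. w ! x"] that by (simp add: nth_tm_factor)
  have factor: "tm_factor (i + x) (i + x + y) = tm_factor (i' + x) (i' + x + y)" if "x + y \<le> n" for x y
    using that letter[of "x + z" for z] by (intro nth_equalityI) (simp_all add: nth_tm_factor add.assoc)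
  have mod: "i mod 2 ^ j = i' mod 2 ^ j"
    using thue_morse_sync[OF letter n] .
  define c m where "c = ceil_div i (2 ^ j)" and "m = 2 ^ j * c - i"
  define N l where "N = (n - m) div 2 ^ j" and "l = (n - m) mod 2 ^ j"
  have im: "i + m = 2 ^ j * c" "m < 2 ^ j"
    using le_mult_ceil_div[of "2 ^ j" i] mult_ceil_div_less[of "2 ^ j" i] by (auto simp: c_def m_def)
  have nm: "n = m + 2 ^ j * N + l" "l < 2 ^ j" using im(2) n by (simp_all add: N_def l_def)
  have "(i' + m) mod 2 ^ j = (i + m) mod 2 ^ j" using mod by (metis mod_add_cong)
  then obtain c' where im': "i' + m = 2 ^ j * c'" using im(1) by auto
  have "weight (tm_factor c (c + N)) = weight (tm_factor c' (c' + N))"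
  proof -
    have "thue_morse (c + x) = thue_morse (c' + x)" if "x < N" for x
    proof -
      have "2 ^ j * Suc x \<le> 2 ^ j * N" using that by (intro mult_le_mono2) simp
      then have "m + 2 ^ j * x < n"
        unfolding nm(1) using zero_less_power[of "2::nat" j] unfolding mult_Suc_right by linarith
      from letter[OF this] have "thue_morse (2 ^ j * (c + x)) = thue_morse (2 ^ j * (c' + x))"
        using im im' by (simp add: distrib_left flip: add.assoc)
      then show ?thesis by simp
    qed
    then show ?thesis by (intro arg_cong[of _ _ weight] nth_equalityI) (simp_all add: nth_tm_factor)
  qed
  moreover have "tm_factor i (i + m) = tm_factor i' (i' + m)"
    using factor[of 0 m] nm by simp
  moreover have "tm_factor (2 ^ j * (c + N)) (2 ^ j * (c + N) + l)
      = tm_factor (2 ^ j * (c' + N)) (2 ^ j * (c' + N) + l)"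
    using factor[of "m + 2 ^ j * N" l] nm im im' by (simp add: distrib_left flip: add.assoc)
  ultimately show ?thesis
    unfolding signature_eq[OF im nm] signature_eq[OF im' im(2) nm] by simp
qed

subsection \<open>Counting signatures\<close>

text \<open>The values of \<open>(t\<^bsub>c-1\<^esub>, t\<^bsub>c+N\<^esub>, weight (t\<^bsub>c\<^esub> \<dots> t\<^bsub>c+N-1\<^esub>))\<close> over all
  \<open>c \<ge> 1\<close>. Pairs of letters \<open>t\<^bsub>2x\<^esub> t\<^bsub>2x+1\<^esub>\<close> have weight 0, so only unpaired letters at the ends
  count.\<close>

definition contexts :: "nat \<Rightarrow> (bool \<times> bool \<times> int) set" where
  "contexts N =
     (if even N then {(False, False, 0), (False, True, 0), (True, False, 0), (True, True, 0),
                      (False, False, 2), (True, True, - 2)}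
      else {(False, False, 1), (False, True, 1), (False, True, - 1),
            (True, False, 1), (True, False, - 1), (True, True, - 1)})"

section \<open>Weights of windows by the parity of their ends\<close>

lemma weight_even_even: "weight (tm_factor (2 * x) (2 * x + 2 * m)) = 0"
  using weight_tm_factor_double[of x "x + m"] by simp

lemma weight_even_odd:
  "weight (tm_factor (2 * x) (2 * x + Suc (2 * m))) = (if thue_morse (x + m) then 1 else - 1)"
proof -
  have "tm_factor (2 * x) (2 * x + Suc (2 * m))
      = tm_factor (2 * x) (2 * (x + m)) @ tm_factor (2 * (x + m)) (Suc (2 * (x + m)))"
    by (subst tm_factor_append) simp_all
  then show ?thesis
    using weight_tm_factor_double[of x "x + m"] thue_morse_double[of "x + m"]
    by (simp del: thue_morse_double)
qed

lemma weight_odd_even: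
  assumes "m \<ge> 1"
  shows "weight (tm_factor (Suc (2 * x)) (Suc (2 * x) + 2 * m)) =
    (if thue_morse x then - 1 else 1) + (if thue_morse (x + m) then 1 else - 1)"
proof -
  have "tm_factor (Suc (2 * x)) (Suc (2 * x) + 2 * m)
      = tm_factor (Suc (2 * x)) (Suc (Suc (2 * x))) @ tm_factor (2 * Suc x) (2 * (x + m))
        @ tm_factor (2 * (x + m)) (Suc (2 * (x + m)))"
    using assms tm_factor_append[of "Suc (2 * x)" "2 * Suc x" "Suc (2 * (x + m))"]
      tm_factor_append[of "2 * Suc x" "2 * (x + m)" "Suc (2 * (x + m))"]
    by simp
  then show ?thesis
    using weight_tm_factor_double[of "Suc x" "x + m"] thue_morse_double[of "x + m"]
    by (simp del: thue_morse_double mult_Suc_right)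
qed

lemma weight_odd_odd:
  "weight (tm_factor (Suc (2 * x)) (Suc (2 * x) + Suc (2 * m))) = (if thue_morse x then - 1 else 1)"
proof -
  have "tm_factor (Suc (2 * x)) (Suc (2 * x) + Suc (2 * m))
      = tm_factor (Suc (2 * x)) (Suc (Suc (2 * x))) @ tm_factor (2 * Suc x) (2 * Suc (x + m))"
    using tm_factor_append[of "Suc (2 * x)" "2 * Suc x" "2 * Suc (x + m)"]
    by simp
  then show ?thesis
    using weight_tm_factor_double[of "Suc x" "Suc (x + m)"]
    by (simp del: mult_Suc_right)
qed

text \<open>The first letter of the window is not paired with its left neighbour, so
  \<open>a\<close> is arbitrary; this also covers the window at 0, which has no left
  neighbour.\<close>

lemma context_even:
  assumes "even c"
  shows "(a, thue_morse (c + N), weight (tm_factor c (c + N))) \<in> contexts N"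
proof -
  obtain x where c: "c = 2 * x" using assms by blast
  show ?thesis
  proof (cases "even N")
    case True
    then obtain m where N: "N = 2 * m" by blast
    show ?thesis unfolding c N weight_even_even[of x m]
      by (cases a; cases "thue_morse (2 * x + 2 * m)") (simp_all add: contexts_def)
  next
    case False
    then obtain m where N: "N = Suc (2 * m)" by (metis oddE Suc_eq_plus1)
    have "thue_morse (2 * x + N) = (\<not> thue_morse (x + m))"
      using thue_morse_Suc_double[of "x + m"] by (simp add: N)
    then show ?thesis unfolding c N weight_even_odd[of x m]
      by (cases a; cases "thue_morse (x + m)") (simp_all add: contexts_def)
  qed
qed

text \<open>The first letter of the window is the complement of its left neighbour, which ties the
  weight to that neighbour.\<close>

lemma context_odd:
  assumes "N \<ge> 1"
  shows "(thue_morse (2 * x), thue_morse (Suc (2 * x) + N),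
          weight (tm_factor (Suc (2 * x)) (Suc (2 * x) + N))) \<in> contexts N"
proof (cases "even N")
  case True
  then obtain m where N: "N = 2 * m" by blast
  have "m \<ge> 1" using assms N by simp
  moreover have "thue_morse (Suc (2 * x) + N) = (\<not> thue_morse (x + m))"
    using thue_morse_Suc_double[of "x + m"] by (simp add: N)
  ultimately show ?thesis unfolding N using weight_odd_even[of m x]
    by (cases "thue_morse x"; cases "thue_morse (x + m)") (simp_all add: contexts_def)
next
  case False
  then obtain m where N: "N = Suc (2 * m)" by (metis oddE Suc_eq_plus1)
  show ?thesis unfolding N weight_odd_odd
    by (cases "thue_morse x"; cases "thue_morse (Suc (2 * x) + Suc (2 * m))")
      (simp_all add: contexts_def)
qed

text \<open>The weight dictates the parity of the start of the window;
  \<open>thue_morse_pair\<close> then supplies both neighbours at the halved distance.\<close>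

lemma contexts_attained:
  assumes "(a, b, v) \<in> contexts N" "N \<ge> 1"
  shows "\<exists>c. a = thue_morse c \<and> b = thue_morse (Suc c + N) \<and>
    v = weight (tm_factor (Suc c) (Suc c + N))"
proof (cases "even N")
  case True
  then obtain m where N: "N = 2 * m" by blast
  have m: "m \<ge> 1" using assms(2) N by simp
  show ?thesis
  proof (cases "v = 0")
    case True
    obtain x where x: "thue_morse x = (\<not> a)" "thue_morse (x + Suc m) = b"
      using thue_morse_pair[of "Suc m" "\<not> a" b] by auto
    have "thue_morse (Suc (Suc (2 * x)) + N) = b"
      using thue_morse_double[of "x + Suc m"] x(2) by (simp add: N)
    moreover have "weight (tm_factor (Suc (Suc (2 * x))) (Suc (Suc (2 * x)) + N)) = 0"
      using weight_even_even[of "Suc x" m] by (simp add: N)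
    ultimately show ?thesis
      using x(1) True thue_morse_Suc_double[of x] by (intro exI[of _ "Suc (2 * x)"]) simp
  next
    case False
    then have v: "a = b" "v = (if a then - 2 else 2)"
      using assms(1) \<open>even N\<close> by (auto simp: contexts_def split: if_splits)
    obtain x where x: "thue_morse x = a" "thue_morse (x + m) = (\<not> b)"
      using thue_morse_pair[OF m, of a "\<not> b"] by auto
    have "thue_morse (Suc (2 * x) + N) = b"
      using thue_morse_Suc_double[of "x + m"] x(2) by (simp add: N)
    then show ?thesis
      using x v weight_odd_even[OF m, of x]
      by (intro exI[of _ "2 * x"]) (simp add: N)
  qed
next
  case False
  then obtain m where N: "N = Suc (2 * m)" by (metis oddE Suc_eq_plus1)
  \<comment> \<open>For odd \<open>N\<close> exactly one letter of the window is unpaired: the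
    complement of the right neighbour if the start is even, of the left one if it is odd.\<close>
  have "v = (if b then - 1 else 1) \<or> v = (if a then - 1 else 1)"
    using assms(1) False by (auto simp: contexts_def split: if_splits)
  then show ?thesis
  proof
    assume v: "v = (if b then - 1 else 1)"
    obtain x where x: "thue_morse x = (\<not> a)" "thue_morse (x + Suc m) = (\<not> b)"
      using thue_morse_pair[of "Suc m" "\<not> a" "\<not> b"] by auto
    have "thue_morse (Suc (Suc (2 * x)) + N) = b"
      using thue_morse_Suc_double[of "x + Suc m"] x(2) by (simp add: N)
    moreover have "weight (tm_factor (Suc (Suc (2 * x))) (Suc (Suc (2 * x)) + N)) = v"
      using weight_even_odd[of "Suc x" m] x(2) v by (simp add: N)
    ultimately show ?thesis
      using x(1) thue_morse_Suc_double[of x] by (intro exI[of _ "Suc (2 * x)"]) simp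
  next
    assume v: "v = (if a then - 1 else 1)"
    obtain x where x: "thue_morse x = a" "thue_morse (x + Suc m) = b"
      using thue_morse_pair[of "Suc m" a b] by auto
    have "thue_morse (Suc (2 * x) + N) = b"
      using thue_morse_double[of "x + Suc m"] x(2) by (simp add: N)
    then show ?thesis
      using x v weight_odd_odd[of x m] by (intro exI[of _ "2 * x"]) (simp add: N)
  qed
qed

text \<open>\<open>P\<close> and \<open>L\<close> stand for the remainders cut from the neighbouring
  half blocks; an empty remainder makes its map constant and forgets that neighbour.\<close>

lemma card_image_contexts:
  "card ((\<lambda>(a, b, v). (P a, L b, v)) ` contexts N) =
    (if P True \<noteq> P False then (if L True \<noteq> L False then 6 else 4)
     else if L True \<noteq> L False then 4 else if even N then 3 else 2)"
proof -
  have "P False \<noteq> P True \<longleftrightarrow> P True \<noteq> P False" "L False \<noteq> L True \<longleftrightarrow> L True \<noteq> L False"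
    by auto
  then show ?thesis
    by (cases "P True = P False"; cases "L True = L False"; cases "even N")
      (simp_all add: contexts_def card_insert_if)
qed

lemma take_tm_factor: "i + x \<le> j \<Longrightarrow> take x (tm_factor i j) = tm_factor i (i + x)"
  by (simp add: tm_factor_def take_map)

lemma drop_tm_factor: "drop x (tm_factor i j) = tm_factor (i + x) j"
  by (simp add: tm_factor_def drop_map)

lemma signatures_eq_image_contexts:
  assumes "n = m + 2 ^ j * N + l" "m < 2 ^ j" "l < 2 ^ j" "N \<ge> 1"
  shows "signature j n ` {i. 2 ^ j dvd i + m} =
    (\<lambda>(a, b, v). (drop (2 ^ j - m) ((tm_morph ^^ j) [a]), take l ((tm_morph ^^ j) [b]), v))
      ` contexts N" (is "?S = ?f ` _")
proof -
  have l: "tm_factor (2 ^ j * d) (2 ^ j * d + l) = take l ((tm_morph ^^ j) [thue_morse d])" for d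
    using assms(3) by (simp add: tm_morph_pow_singleton take_tm_factor)
  have sig: "signature j n i
      = ?f (thue_morse c, thue_morse (Suc c + N), weight (tm_factor (Suc c) (Suc c + N)))"
    if i: "i + m = 2 ^ j * Suc c" for i c
  proof -
    have "2 ^ j * c + (2 ^ j - m) = i" using i assms(2) by simp
    then have "tm_factor i (i + m) = drop (2 ^ j - m) ((tm_morph ^^ j) [thue_morse c])"
      unfolding tm_morph_pow_singleton drop_tm_factor i by simp
    then show ?thesis
      unfolding signature_eq[OF i assms(2,1,3)] l by simp
  qed
  show ?thesis
  proof
    show "?S \<subseteq> ?f ` contexts N"
    proof
      fix y assume "y \<in> ?S"
      then obtain i c where y: "y = signature j n i" and i: "i + m = 2 ^ j * c" by auto
      show "y \<in> ?f ` contexts N"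
      proof (cases c)
        \<comment> \<open>There is no left neighbour at position 0, but \<open>m = 0\<close> makes
          the left remainder empty, so \<open>False\<close> can serve as one.\<close>
        case 0
        with i have "i = 0" "m = 0" by simp_all
        then have "y = ?f (False, thue_morse (0 + N), weight (tm_factor 0 (0 + N)))"
          unfolding y signature_eq[OF i assms(2,1,3)] l using 0 by simp
        then show ?thesis using imageI[OF context_even[of 0 False N], of ?f] by simp
      next
        case (Suc c')
        have "(thue_morse c', thue_morse (Suc c' + N), weight (tm_factor (Suc c') (Suc c' + N)))
            \<in> contexts N"
        proof (cases "even c'")
          case True
          then show ?thesis using context_odd[OF assms(4)] by blast
        next
          case False
          then show ?thesis using context_even[of "Suc c'" _ N] by simp
        qed
        then show ?thesis unfolding y sig[OF i[unfolded Suc]] by (rule imageI)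
      qed
    qed
    show "?f ` contexts N \<subseteq> ?S"
    proof
      fix y assume "y \<in> ?f ` contexts N"
      then obtain a b v where abv: "(a, b, v) \<in> contexts N" "y = ?f (a, b, v)" by auto
      obtain c where c: "a = thue_morse c" "b = thue_morse (Suc c + N)"
        "v = weight (tm_factor (Suc c) (Suc c + N))"
        using contexts_attained[OF abv(1) assms(4)] by blast
      have i: "(2 ^ j * Suc c - m) + m = 2 ^ j * Suc c"
        using assms(2) by simp
      have "y = signature j n (2 ^ j * Suc c - m)"
        unfolding sig[OF i] abv(2) c ..
      then show "y \<in> ?S" using i by (auto intro!: imageI)
    qed
  qed
qed

text \<open>The blocks of the two letters differ at every position, so comparing one letter
  suffices.\<close>

lemma take_tm_morph_pow_letter_eq_iff:
  assumes "l < 2 ^ j"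
  shows "take l ((tm_morph ^^ j) [True]) = take l ((tm_morph ^^ j) [False]) \<longleftrightarrow> l = 0"
proof (rule iffI, rule ccontr)
  assume eq: "take l ((tm_morph ^^ j) [True]) = take l ((tm_morph ^^ j) [False])" and "l \<noteq> 0"
  from eq have "take l ((tm_morph ^^ j) [True]) ! 0 = take l ((tm_morph ^^ j) [False]) ! 0" by simp
  then show False
    using \<open>l \<noteq> 0\<close> assms by (simp add: nth_tm_morph_pow_singleton)
qed simp

lemma drop_tm_morph_pow_letter_eq_iff:
  assumes "m < 2 ^ j"
  shows "drop (2 ^ j - m) ((tm_morph ^^ j) [True]) = drop (2 ^ j - m) ((tm_morph ^^ j) [False])
    \<longleftrightarrow> m = 0"
proof (rule iffI, rule ccontr)
  assume eq: "drop (2 ^ j - m) ((tm_morph ^^ j) [True]) = drop (2 ^ j - m) ((tm_morph ^^ j) [False])"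
    and m: "m \<noteq> 0"
  from eq have "drop (2 ^ j - m) ((tm_morph ^^ j) [True]) ! 0
      = drop (2 ^ j - m) ((tm_morph ^^ j) [False]) ! 0" by simp
  then show False
    using m assms by (simp add: nth_tm_morph_pow_singleton)
qed simp

lemma card_signatures_residue:
  assumes "2 * 2 ^ j \<le> n" "m < 2 ^ j"
  shows "card (signature j n ` {i. 2 ^ j dvd i + m}) =
    (if m \<noteq> 0 then (if (n - m) mod 2 ^ j \<noteq> 0 then 6 else 4)
     else if n mod 2 ^ j \<noteq> 0 then 4 else if even (n div 2 ^ j) then 3 else 2)"
proof -
  define N l where "N = (n - m) div 2 ^ j" and "l = (n - m) mod 2 ^ j"
  have nm: "n = m + 2 ^ j * N + l" "l < 2 ^ j" using assms by (simp_all add: N_def l_def)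
  have "2 ^ j \<le> n - m" using assms by linarith
  then have "1 \<le> N" by (simp add: N_def Suc_le_eq div_greater_zero_iff)
  then show ?thesis
    unfolding signatures_eq_image_contexts[OF nm(1) assms(2) nm(2) \<open>1 \<le> N\<close>] card_image_contexts
      take_tm_morph_pow_letter_eq_iff[OF nm(2)] drop_tm_morph_pow_letter_eq_iff[OF assms(2)]
    by (simp add: N_def l_def)
qed

lemma card_signatures:
  assumes n: "2 * 2 ^ j \<le> n"
  shows "card (range (signature j n)) =
    (if n mod (2 * 2 ^ j) = 0 then 6 * 2 ^ j - 3 else 6 * 2 ^ j - 4)"
proof -
  let ?S = "\<lambda>m. signature j n ` {i. 2 ^ j dvd i + m}"
  have ex: "\<exists>m<2 ^ j. 2 ^ j dvd i + m" for i :: nat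
    using le_mult_ceil_div[of "2 ^ j" i] mult_ceil_div_less[of "2 ^ j" i]
    by (intro exI[of _ "2 ^ j * ceil_div i (2 ^ j) - i"]) auto
  have range: "range (signature j n) = (\<Union>m<2 ^ j. ?S m)" using ex by blast
  have finite: "finite (?S m)" if "m < 2 ^ j" for m
    using card_signatures_residue[OF n that] by (intro card_ge_0_finite) auto
  \<comment> \<open>The length of the first component recovers \<open>m\<close>, which makes the
    residue classes contribute disjoint sets.\<close>
  have fst: "length (fst (signature j n i)) = m" if "2 ^ j dvd i + m" "m < 2 ^ j" for i m
  proof -
    from that(1) obtain c where c: "i + m = 2 ^ j * c" by blast
    then show ?thesis
      unfolding signature_def ceil_div_eqI[OF c that(2)] using c by simp
  qed
  have "card (range (signature j n)) = (\<Sum>m<2 ^ j. card (?S m))"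
    unfolding range
  proof (rule card_UN_disjoint)
    show "\<forall>m\<in>{..<2 ^ j}. \<forall>m'\<in>{..<2 ^ j}. m \<noteq> m' \<longrightarrow> ?S m \<inter> ?S m' = {}"
    proof (intro ballI impI equals0I)
      fix m m' :: nat and y
      assume m: "m \<in> {..<2 ^ j}" "m' \<in> {..<2 ^ j}" "m \<noteq> m'" and "y \<in> ?S m \<inter> ?S m'"
      then obtain i i' where "y = signature j n i" "2 ^ j dvd i + m"
        "y = signature j n i'" "2 ^ j dvd i' + m'" by blast
      then have "m = m'" using fst[of i m] fst[of i' m'] m(1,2) by simp
      with m(3) show False ..
    qed
    show "\<forall>m\<in>{..<2 ^ j}. finite (?S m)" using finite by blast
  qed simp
  also have "\<dots> = (\<Sum>m<2 ^ j. if m \<noteq> 0 then (if (n - m) mod 2 ^ j \<noteq> 0 then 6 else 4)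
     else if n mod 2 ^ j \<noteq> 0 then 4 else if even (n div 2 ^ j) then 3 else 2)" (is "_ = sum ?v _")
    by (rule sum.cong[OF refl]) (rule card_signatures_residue[OF n], simp)
  also have "\<dots> = (if n mod (2 * 2 ^ j) = 0 then 6 * 2 ^ j - 3 else 6 * 2 ^ j - 4)"
  proof -
    define r where "r = n mod 2 ^ j"
    have r: "r < 2 ^ j" by (simp add: r_def)
    have l: "(n - m) mod 2 ^ j = 0 \<longleftrightarrow> m = r" if "m < 2 ^ j" for m
    proof -
      have "(n - m) mod 2 ^ j = 0 \<longleftrightarrow> n mod 2 ^ j = m mod 2 ^ j"
        using that n mod_eq_dvd_iff_nat[of m n "2 ^ j"] by (simp add: mod_eq_0_iff_dvd)
      then show ?thesis using that by (auto simp: r_def)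
    qed
    have mod: "n mod (2 * 2 ^ j) = 0 \<longleftrightarrow> r = 0 \<and> even (n div 2 ^ j)"
      unfolding r_def mult.commute[of 2 "2 ^ j"] mod_mult2_eq by (auto simp: even_iff_mod_2_eq_zero)
    have pos: "(0::nat) < 2 ^ j" by simp
    show ?thesis
    proof (cases "r = 0")
      case True
      \<comment> \<open>The deficit from 6 is added on the left to avoid truncated subtraction. Both
        remainders are empty only at \<open>m = 0\<close>, with deficit 3 or 4; for \<open>r\<close>
        nonzero the deficits are 2 at \<open>m = 0\<close> and 2 at \<open>m = r\<close>.\<close>
      have "(\<Sum>m<2 ^ j. ?v m + (if m = 0 then if even (n div 2 ^ j) then 3 else 4 else 0))
          = (\<Sum>m<(2::nat) ^ j. (6::nat))"
        using l True by (intro sum.cong) (auto simp: r_def)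
      then show ?thesis using True mod pos by (simp add: sum.distrib split: if_splits)
    next
      case False
      have "(\<Sum>m<2 ^ j. (?v m + (if m = 0 then 2 else 0)) + (if m = r then 2 else 0))
          = (\<Sum>m<(2::nat) ^ j. (6::nat))"
        using l False by (intro sum.cong) (auto simp: r_def)
      then show ?thesis using False mod pos r unfolding sum.distrib by simp
    qed
  qed
  finally show ?thesis .
qed

text \<open>Transitivity of \<open>r\<close> is not assumed: on \<open>S\<close> the relation is the
  kernel of \<open>g\<close>, so its classes are the fibres of \<open>g\<close>.\<close>

lemma card_quotient_kernel:
  assumes "\<And>x y. x \<in> S \<Longrightarrow> y \<in> S \<Longrightarrow> (x, y) \<in> r \<longleftrightarrow> g x = g y"
  shows "card (S // (r \<inter> S \<times> S)) = card (g ` S)"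
proof -
  have "(r \<inter> S \<times> S) `` {x} = {y \<in> S. g y = g x}" if "x \<in> S" for x
    using assms that by auto
  then have "S // (r \<inter> S \<times> S) = (\<lambda>v. {y \<in> S. g y = v}) ` g ` S"
    unfolding quotient_def by auto
  moreover have "inj_on (\<lambda>v. {y \<in> S. g y = v}) (g ` S)"
    by (rule inj_onI) blast
  ultimately show ?thesis by (simp add: card_image)
qed

theorem theorem8p3:
  fixes k n :: nat
  assumes "k \<ge> 3" and "n \<ge> 2 ^ k"
  shows "card (fact_quotient k {min_factorization k u | u. u \<in> Fac n}) =
           (if n mod 2 ^ k = 0 then 3 * 2 ^ k - 3 else 3 * 2 ^ k - 4)"
proof -
  obtain j where k: "k = Suc j" using assms(1) by (cases k) auto
  have n: "2 * 2 ^ j \<le> n" using assms(2) k by simp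
  let ?S = "{min_factorization k u | u. u \<in> Fac n}"
  \<comment> \<open>The choice of occurrence is harmless: a factorization shared by two occurrences
    is equivalent to itself, which forces their signatures to agree.\<close>
  define g where "g x = signature j n (SOME i. x = factorization_at k n i)" for x
  have g: "g (factorization_at k n i) = signature j n i" for i
  proof -
    have "factorization_at k n i
        = factorization_at k n (SOME i'. factorization_at k n i = factorization_at k n i')"
      by (rule someI) simp
    moreover have "(factorization_at k n i, factorization_at k n i) \<in> fact_equiv k"
      unfolding k fact_equiv_iff_signature_eq[OF n] ..
    ultimately show ?thesis
      unfolding g_def using fact_equiv_iff_signature_eq[OF n] k by metis
  qed
  have S: "\<exists>i. x = factorization_at k n i" if "x \<in> ?S" for x
    using that min_factorization_eq_factorization_at[OF assms(2)] unfolding Fac_def by blast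
  have "card (fact_quotient k ?S) = card (g ` ?S)"
    unfolding fact_quotient_def
  proof (rule card_quotient_kernel)
    fix x y assume "x \<in> ?S" "y \<in> ?S"
    then obtain i i' where xy: "x = factorization_at k n i" "y = factorization_at k n i'"
      using S[of x] S[of y] by blast
    show "(x, y) \<in> fact_equiv k \<longleftrightarrow> g x = g y"
      unfolding xy g unfolding k by (rule fact_equiv_iff_signature_eq[OF n])
  qed
  also have "g ` ?S = range (signature j n)"
  proof
    show "g ` ?S \<subseteq> range (signature j n)" using S g by fastforce
    show "range (signature j n) \<subseteq> g ` ?S"
    proof
      fix y assume "y \<in> range (signature j n)"
      then obtain i where y: "y = signature j n i" by blast
      obtain i' where eq: "tm_factor i' (i' + n) = tm_factor i (i + n)"
        and i': "min_factorization k (tm_factor i (i + n)) = factorization_at k n i'"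
        by (rule min_factorization_eq_factorization_at[OF assms(2)])
      \<comment> \<open>The chosen factorization may come from the occurrence at \<open>i'\<close>,
        but occurrences of the same factor share a signature.\<close>
      then have "y = g (min_factorization k (tm_factor i (i + n)))"
        unfolding y i' g by (intro signature_cong[OF n] sym[OF eq])
      then show "y \<in> g ` ?S" unfolding Fac_def by blast
    qed
  qed
  also have "card (range (signature j n))
      = (if n mod 2 ^ k = 0 then 3 * 2 ^ k - 3 else 3 * 2 ^ k - 4)"
    unfolding card_signatures[OF n] k by simp
  finally show ?thesis .
qed

end
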